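(* Let $G_1,G_2$ be finite simple connected graphs, $G_i$ having $n_i$ vertices and $m_i$ edges. Then the composition $G_1[G_2]$ satisfies \[F(G_1[G_2])=n_2^4F(G_1)+n_1F(G_2)+6n_2^2m_2M_1(G_1)+6n_2m_1M_1(G_2).\]
   Context: The composition (lexicographic product) $G_1[G_2]$ has vertex set $V(G_1)\times V(G_2)$, with $(u_1,u_2)$ adjacent to $(v_1,v_2)$ iff $u_1v_1\in E(G_1)$, or [$u_1=v_1$ and $u_2v_2\in E(G_2)$]. For a finite simple graph $G$ with vertex degrees $d_G(v)$: $M_1(G)=\sum_{v} d_G(v)^2$ and $F(G)=\sum_{v} d_G(v)^3$. *)

theory Defs
  imports "Graph_Theory.Pair_Digraph" "Graph_Theory.Digraph_Component"
begin

text \<open>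
  Finite simple graphs are the instances of \<^locale>\<open>pair_graph\<close>: finite, loopfree, with a symmetric
  arc relation. An undirected edge $uv$ is thus represented by the two arcs $(u,v)$ and $(v,u)$,
  so edges are counted below as unordered pairs, while the degree of a vertex is its
  \<^const>\<open>out_degree\<close> (see \<open>deg_eq_card_incident_edges\<close>).
\<close>

definition edges :: "'a pair_pre_digraph \<Rightarrow> 'a set set" where
  "edges G = {{u, v} | u v. (u, v) \<in> parcs G}"

definition deg :: "'a pair_pre_digraph \<Rightarrow> 'a \<Rightarrow> nat" where
  "deg G v = out_degree (with_proj G) v"

definition first_zagreb_index :: "'a pair_pre_digraph \<Rightarrow> nat" where
  "first_zagreb_index G = (\<Sum>v\<in>pverts G. deg G v ^ 2)"

definition F_index :: "'a pair_pre_digraph \<Rightarrow> nat" where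
  "F_index G = (\<Sum>v\<in>pverts G. deg G v ^ 3)"

definition composition ::
  "'a pair_pre_digraph \<Rightarrow> 'b pair_pre_digraph \<Rightarrow> ('a \<times> 'b) pair_pre_digraph" where
  "composition G1 G2 = \<lparr>
     pverts = pverts G1 \<times> pverts G2,
     parcs = {((u1, u2), (v1, v2)) | u1 u2 v1 v2.
       (u1, u2) \<in> pverts G1 \<times> pverts G2 \<and> (v1, v2) \<in> pverts G1 \<times> pverts G2 \<and>
       ((u1, v1) \<in> parcs G1 \<or> u1 = v1 \<and> (u2, v2) \<in> parcs G2)} \<rparr>"

lemma pair_graph_symD:
  assumes "pair_graph G" "(u, v) \<in> parcs G"
  shows "(v, u) \<in> parcs G"
proof -
  interpret pair_graph G by fact
  show ?thesis using pair_sym_arcs assms(2) by (auto simp: symmetric_def sym_def)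
qed

lemma deg_eq_card_incident_edges:
  assumes "pair_graph G"
  shows "deg G v = card {e \<in> edges G. v \<in> e}"
proof -
  have "bij_betw (\<lambda>a. {fst a, snd a}) {a \<in> parcs G. fst a = v} {e \<in> edges G. v \<in> e}"
    unfolding bij_betw_def inj_on_def edges_def
    by (auto simp: doubleton_eq_iff image_iff insert_commute)
       (use pair_graph_symD[OF assms] in \<open>force simp: insert_commute\<close>)+
  then show ?thesis
    by (simp add: deg_def out_degree_def out_arcs_def bij_betw_same_card)
qed

lemma pair_graph_composition:
  assumes "pair_graph G1" "pair_graph G2"
  shows "pair_graph (composition G1 G2)"
proof -
  interpret G1: pair_graph G1 by fact
  interpret G2: pair_graph G2 by fact
  have "parcs (composition G1 G2) \<subseteq>
      (pverts G1 \<times> pverts G2) \<times> (pverts G1 \<times> pverts G2)"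
    by (auto simp: composition_def)
  then have "finite (parcs (composition G1 G2))"
    by (rule finite_subset) (simp add: G1.pair_finite_verts G2.pair_finite_verts)
  then show ?thesis
    by unfold_locales
       (auto simp: composition_def symmetric_def sym_def G1.pair_finite_verts G2.pair_finite_verts
         dest: pair_graph_symD[OF assms(1)] pair_graph_symD[OF assms(2)]
           G1.pair_no_loops G2.pair_no_loops)
qed

end

theory Submission
  imports Defs
begin

lemma deg_eq_card_neighbours: "deg G v = card {w. (v, w) \<in> parcs G}"
proof -
  have "{a \<in> parcs G. fst a = v} = Pair v ` {w. (v, w) \<in> parcs G}"
    by auto
  then show ?thesis
    by (simp add: deg_def out_degree_def out_arcs_def card_image inj_on_def)
qed

lemma sum_deg_eq_twice_card_edges:
  assumes "pair_graph G"
  shows "(\<Sum>v\<in>pverts G. deg G v) = 2 * card (edges G)"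
proof -
  interpret pair_graph G by fact
  have "edges G = (\<lambda>a. {fst a, snd a}) ` parcs G"
    by (force simp: edges_def)
  then have "finite (edges G)"
    by (simp add: pair_finite_arcs)
  moreover have "card {v \<in> pverts G. v \<in> e} = 2" if e: "e \<in> edges G" for e
  proof -
    obtain u v where uv: "e = {u, v}" "(u, v) \<in> parcs G"
      using e by (auto simp: edges_def)
    then have "u \<in> pverts G" "v \<in> pverts G" "u \<noteq> v"
      using in_arcsD1 in_arcsD2 pair_no_loops by fastforce+
    then have "{v \<in> pverts G. v \<in> e} = {u, v}" "card {u, v} = 2"
      using uv by auto
    then show ?thesis by simp
  qed
  ultimately show ?thesis
    unfolding deg_eq_card_incident_edges[OF assms]
    by (intro sum_multicount) (auto simp: pair_finite_verts)
qed

lemma deg_composition: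
  assumes "pair_graph G1" "pair_graph G2" "u1 \<in> pverts G1" "u2 \<in> pverts G2"
  shows "deg (composition G1 G2) (u1, u2) = card (pverts G2) * deg G1 u1 + deg G2 u2"
proof -
  interpret G1: pair_graph G1 by fact
  interpret G2: pair_graph G2 by fact
  let ?N1 = "{w. (u1, w) \<in> parcs G1}" and ?N2 = "{w. (u2, w) \<in> parcs G2}"
  have "?N1 \<subseteq> pverts G1" "?N2 \<subseteq> pverts G2"
    using G1.in_arcsD2 G2.in_arcsD2 by auto
  then have fin: "finite ?N1" "finite ?N2"
    and nbrs: "{w. ((u1, u2), w) \<in> parcs (composition G1 G2)} = ?N1 \<times> pverts G2 \<union> {u1} \<times> ?N2"
    using assms(3,4) finite_subset G1.pair_finite_verts G2.pair_finite_verts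
    by (blast, blast, auto simp: composition_def)
  have "(?N1 \<times> pverts G2) \<inter> ({u1} \<times> ?N2) = {}"
    using G1.pair_no_loops by fastforce
  then show ?thesis
    using fin
    by (simp add: deg_eq_card_neighbours nbrs card_Un_disjoint card_cartesian_product
        G2.pair_finite_verts)
qed

theorem theorem5:
  fixes G1 :: "'a pair_pre_digraph" and G2 :: "'b pair_pre_digraph"
    and n1 n2 m1 m2 :: nat
  assumes "pair_graph G1" and "connected (with_proj G1)"
    and "pair_graph G2" and "connected (with_proj G2)"
    and "n1 = card (pverts G1)" and "m1 = card (edges G1)"
    and "n2 = card (pverts G2)" and "m2 = card (edges G2)"
  shows "F_index (composition G1 G2) =
    n2 ^ 4 * F_index G1 + n1 * F_index G2
    + 6 * n2 ^ 2 * m2 * first_zagreb_index G1 + 6 * n2 * m1 * first_zagreb_index G2"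
proof -
  let ?V1 = "pverts G1" and ?V2 = "pverts G2"
  have cube: "(n2 * a + b) ^ 3 = n2 ^ 3 * a ^ 3 + 3 * n2 ^ 2 * a ^ 2 * b + 3 * n2 * a * b ^ 2 + b ^ 3"
    for a b :: nat
    by (simp add: power3_eq_cube power2_eq_square algebra_simps)
  have inner: "(\<Sum>v\<in>?V2. (n2 * a + deg G2 v) ^ 3) =
      n2 ^ 4 * a ^ 3 + 6 * n2 ^ 2 * m2 * a ^ 2 + 3 * n2 * first_zagreb_index G2 * a + F_index G2"
    for a :: nat
  proof -
    have "(\<Sum>v\<in>?V2. (n2 * a + deg G2 v) ^ 3) =
        n2 * (n2 ^ 3 * a ^ 3) + 3 * n2 ^ 2 * a ^ 2 * (\<Sum>v\<in>?V2. deg G2 v)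
        + 3 * n2 * a * first_zagreb_index G2 + F_index G2"
      by (simp add: cube sum.distrib first_zagreb_index_def F_index_def
          flip: sum_distrib_left assms(7))
    then show ?thesis
      by (simp add: sum_deg_eq_twice_card_edges[OF assms(3)] assms(8) power4_eq_xxxx
          power3_eq_cube algebra_simps)
  qed
  have "F_index (composition G1 G2) = (\<Sum>u\<in>?V1. \<Sum>v\<in>?V2. (n2 * deg G1 u + deg G2 v) ^ 3)"
    by (auto simp: F_index_def composition_def[THEN arg_cong, of pverts] sum.cartesian_product
        deg_composition[OF assms(1,3)] assms(7) intro!: sum.cong)
  also have "\<dots> = n2 ^ 4 * F_index G1 + 6 * n2 ^ 2 * m2 * first_zagreb_index G1
      + 3 * n2 * first_zagreb_index G2 * (\<Sum>u\<in>?V1. deg G1 u) + n1 * F_index G2"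
    by (simp add: inner sum.distrib first_zagreb_index_def[of G1] F_index_def[of G1] assms(5)
        flip: sum_distrib_left)
  finally show ?thesis
    by (simp add: sum_deg_eq_twice_card_edges[OF assms(1)] assms(6))
qed

end
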